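(* Let $N=\{1,\dots,n\}$ be a set of firms competing in an oligopoly with market price $P=\alpha-\sum_{i\in N}q_i$, and suppose the marginal cost for firm $i$ on the graph $g$ is $c_i(g)=\gamma_0+f(\eta_i(g))$, where $\alpha,\gamma_0\in\mathbb{R}$ and $f:\mathbb{R}\to\mathbb{R}$. Define $\triangle f(k)=f(k+1)-f(k)$. Suppose that: (1) $x_1>x_2$ implies $f(x_1)<f(x_2)$; (2) $f$ is convex; (3) $f$ is positive; (4) $\alpha-\gamma_0>n f(0)$; and (5) $\triangle f(k_1)-n\,\triangle f(k_2)>0$ for all $k_1,k_2\in\{0,1,\dots,n-1\}$. Then the complete network $g^c$ is a stable graph (pairwise stable with respect to the profits $Y_1,\dots,Y_n$ induced by the Cournot equilibrium of the oligopoly).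
   Context: A (collaboration) graph $g$ on the node set $N=\{1,\dots,n\}$ of firms is a set of links, where a link $ij$ is a two-element subset $\{i,j\}$ of $N$. The complete graph $g^c$ is the set of all two-element subsets of $N$. $g+ij$ is $g$ with the link $ij$ added, $g-ij$ is $g$ with the link $ij$ removed, and $\eta_i(g)$ is the degree of node $i$ in $g$. Given a graph $g$, firm $i$ has constant marginal cost $c_i(g)$ and produces a quantity $q_i$; the market price is $P=\alpha-\sum_{j\in N}q_j$. The firms play the Cournot equilibrium of quantities induced by $g$ (no sign constraint on quantities being imposed), which is $$q_i(g)=\frac{\alpha-\gamma_0-n f(\eta_i(g))+\sum_{j\ne i}f(\eta_j(g))}{n+1},$$ and the profit (allocation) of firm $i$ on the graph $g$ is $$Y_i(g)=q_i(g)\Bigl(\alpha-\sum_{j\in N}q_j(g)-c_i(g)\Bigr).$$ A graph $g$ is (pairwise) stable if and only if: (1) for all $ij\in g$, $Y_i(g)\ge Y_i(g-ij)$ (for each of the two endpoints of the link); and (2) for all $ij\notin g$ (with $i\ne j$), if $Y_i(g+ij)>Y_i(g)$ then $Y_j(g+ij)<Y_j(g)$ (for each ordering of the two endpoints). *)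

theory Defs
  imports "HOL-Analysis.Convex"
begin

type_synonym graph = "nat set set"

definition firms :: "nat \<Rightarrow> nat set" where
  "firms n = {1..n}"

definition complete_graph :: "nat \<Rightarrow> graph" where
  "complete_graph n = {e. e \<subseteq> firms n \<and> card e = 2}"

definition add_link :: "graph \<Rightarrow> nat \<Rightarrow> nat \<Rightarrow> graph" where
  "add_link g i j = g \<union> {{i, j}}"

definition remove_link :: "graph \<Rightarrow> nat \<Rightarrow> nat \<Rightarrow> graph" where
  "remove_link g i j = g - {{i, j}}"

definition degree :: "graph \<Rightarrow> nat \<Rightarrow> nat" where
  "degree g i = card {e \<in> g. i \<in> e}"

definition price :: "nat \<Rightarrow> real \<Rightarrow> (nat \<Rightarrow> real) \<Rightarrow> real" where
  "price n \<alpha> q = \<alpha> - (\<Sum>j\<in>firms n. q j)"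

definition marginal_cost :: "real \<Rightarrow> (real \<Rightarrow> real) \<Rightarrow> graph \<Rightarrow> nat \<Rightarrow> real" where
  "marginal_cost \<gamma>0 f g i = \<gamma>0 + f (real (degree g i))"

definition profit :: "nat \<Rightarrow> real \<Rightarrow> real \<Rightarrow> (real \<Rightarrow> real) \<Rightarrow> graph \<Rightarrow> (nat \<Rightarrow> real) \<Rightarrow> nat \<Rightarrow> real" where
  "profit n \<alpha> \<gamma>0 f g q i = q i * (price n \<alpha> q - marginal_cost \<gamma>0 f g i)"

text \<open>Quantities range over all reals: there is no sign constraint on them.\<close>

definition cournot_equilibrium ::
    "nat \<Rightarrow> real \<Rightarrow> real \<Rightarrow> (real \<Rightarrow> real) \<Rightarrow> graph \<Rightarrow> (nat \<Rightarrow> real) \<Rightarrow> bool" where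
  "cournot_equilibrium n \<alpha> \<gamma>0 f g q \<longleftrightarrow>
     (\<forall>i\<in>firms n. \<forall>x. profit n \<alpha> \<gamma>0 f g (q(i := x)) i \<le> profit n \<alpha> \<gamma>0 f g q i)"

text \<open>The closed form of the equilibrium quantities; the lemma
  \<open>cournot_equilibrium_iff\<close> below shows that they are the unique Cournot equilibrium.\<close>

definition cournot_quantity ::
    "nat \<Rightarrow> real \<Rightarrow> real \<Rightarrow> (real \<Rightarrow> real) \<Rightarrow> graph \<Rightarrow> nat \<Rightarrow> real" where
  "cournot_quantity n \<alpha> \<gamma>0 f g i =
     (\<alpha> - \<gamma>0 - real n * f (real (degree g i))
        + (\<Sum>j\<in>firms n - {i}. f (real (degree g j)))) / (real n + 1)"

definition cournot_profit ::
    "nat \<Rightarrow> real \<Rightarrow> real \<Rightarrow> (real \<Rightarrow> real) \<Rightarrow> nat \<Rightarrow> graph \<Rightarrow> real" where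
  "cournot_profit n \<alpha> \<gamma>0 f i g = profit n \<alpha> \<gamma>0 f g (cournot_quantity n \<alpha> \<gamma>0 f g) i"

text \<open>Both quantifiers range over ordered pairs \<open>(i, j)\<close>, so each condition is
  imposed on both endpoints of the link. In the first condition \<open>i \<noteq> j\<close> is automatic,
  as a graph has only two-element links.\<close>

definition pairwise_stable :: "nat \<Rightarrow> (nat \<Rightarrow> graph \<Rightarrow> real) \<Rightarrow> graph \<Rightarrow> bool" where
  "pairwise_stable n Y g \<longleftrightarrow>
     g \<subseteq> complete_graph n \<and>
     (\<forall>i\<in>firms n. \<forall>j\<in>firms n. {i, j} \<in> g \<longrightarrow> Y i g \<ge> Y i (remove_link g i j)) \<and>
     (\<forall>i\<in>firms n. \<forall>j\<in>firms n. i \<noteq> j \<and> {i, j} \<notin> g \<longrightarrow>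
        Y i (add_link g i j) > Y i g \<longrightarrow> Y j (add_link g i j) < Y j g)"

definition forward_diff :: "(real \<Rightarrow> real) \<Rightarrow> real \<Rightarrow> real" where
  "forward_diff f k = f (k + 1) - f k"

lemma quadratic_max_iff:
  fixes a y :: real
  shows "(\<forall>x. x * (a - x) \<le> y * (a - y)) \<longleftrightarrow> 2 * y = a"
proof
  assume "\<forall>x. x * (a - x) \<le> y * (a - y)"
  then have "(a/2) * (a - a/2) \<le> y * (a - y)" by blast
  then have "(2 * y - a)\<^sup>2 \<le> 0"
    by (simp add: power2_eq_square field_simps)
  then show "2 * y = a" by simp
next
  assume *: "2 * y = a"
  have "y * (a - y) - x * (a - x) = (x - y)\<^sup>2" for x
    by (simp add: *[symmetric] power2_eq_square algebra_simps)
  then show "\<forall>x. x * (a - x) \<le> y * (a - y)"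
    by (metis diff_ge_0_iff_ge zero_le_power2)
qed

lemma cournot_equilibrium_iff:
  "cournot_equilibrium n \<alpha> \<gamma>0 f g q \<longleftrightarrow>
     (\<forall>i\<in>firms n. q i = cournot_quantity n \<alpha> \<gamma>0 f g i)"
proof -
  define N where "N = firms n"
  define F where "F i = f (real (degree g i))" for i
  define S where "S = (\<Sum>j\<in>N. F j)"
  have fin: "finite N" and card: "card N = n" by (simp_all add: N_def firms_def)
  have CQ: "cournot_quantity n \<alpha> \<gamma>0 f g i = (\<alpha> - \<gamma>0 - (real n + 1) * F i + S) / (real n + 1)"
    if "i \<in> N" for i
    using fin that
    by (simp add: cournot_quantity_def S_def F_def N_def[symmetric] sum.remove[OF fin that] algebra_simps)
  have foc: "(\<forall>x. profit n \<alpha> \<gamma>0 f g (q(i := x)) i \<le> profit n \<alpha> \<gamma>0 f g q i) \<longleftrightarrow>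
      q i = \<alpha> - \<gamma>0 - F i - (\<Sum>j\<in>N. q j)" if i: "i \<in> N" for i
  proof -
    define R where "R = (\<Sum>j\<in>N - {i}. q j)"
    have pr: "profit n \<alpha> \<gamma>0 f g (q(i := x)) i = x * ((\<alpha> - \<gamma>0 - F i - R) - x)" for x
    proof -
      have "(\<Sum>j\<in>N. (q(i := x)) j) = x + R"
        unfolding R_def by (subst sum.remove[OF fin i]) (auto intro: sum.cong)
      then show ?thesis
        by (simp add: profit_def price_def marginal_cost_def F_def N_def algebra_simps)
    qed
    have "(\<Sum>j\<in>N. q j) = q i + R" unfolding R_def by (rule sum.remove[OF fin i])
    moreover have "profit n \<alpha> \<gamma>0 f g q i = q i * ((\<alpha> - \<gamma>0 - F i - R) - q i)"
      using pr[of "q i"] by simp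
    ultimately show ?thesis
      unfolding pr using quadratic_max_iff[of "\<alpha> - \<gamma>0 - F i - R" "q i"] by auto
  qed
  have n1: "real n + 1 \<noteq> 0" by linarith
  have "cournot_equilibrium n \<alpha> \<gamma>0 f g q \<longleftrightarrow>
      (\<forall>i\<in>N. q i = \<alpha> - \<gamma>0 - F i - (\<Sum>j\<in>N. q j))"
    unfolding cournot_equilibrium_def N_def[symmetric] using foc by blast
  also have "\<dots> \<longleftrightarrow> (\<forall>i\<in>N. q i = cournot_quantity n \<alpha> \<gamma>0 f g i)" (is "?L \<longleftrightarrow> ?R")
  proof
    assume L: ?L
    have "(\<Sum>j\<in>N. q j) = (\<Sum>i\<in>N. \<alpha> - \<gamma>0 - F i - (\<Sum>j\<in>N. q j))"
      using L by (intro sum.cong) auto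
    also have "\<dots> = real n * (\<alpha> - \<gamma>0 - (\<Sum>j\<in>N. q j)) - S"
      by (simp add: sum_subtractf sum.distrib S_def card algebra_simps)
    finally have "(real n + 1) * (\<Sum>j\<in>N. q j) = real n * (\<alpha> - \<gamma>0) - S"
      by (simp add: algebra_simps)
    then have Q: "(\<Sum>j\<in>N. q j) = (real n * (\<alpha> - \<gamma>0) - S) / (real n + 1)"
      using n1 by (simp add: field_simps)
    show ?R
    proof
      fix i assume i: "i \<in> N"
      have "q i = \<alpha> - \<gamma>0 - F i - (real n * (\<alpha> - \<gamma>0) - S) / (real n + 1)"
        using L i Q by metis
      then show "q i = cournot_quantity n \<alpha> \<gamma>0 f g i"
        unfolding CQ[OF i] using n1 by (simp add: field_simps)
    qed
  next
    assume R: ?R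
    have "(\<Sum>j\<in>N. q j) = (\<Sum>i\<in>N. (\<alpha> - \<gamma>0 - (real n + 1) * F i + S) / (real n + 1))"
      using R CQ by (intro sum.cong) auto
    also have "\<dots> = (real n * (\<alpha> - \<gamma>0 + S) - (real n + 1) * S) / (real n + 1)"
      by (simp add: sum_divide_distrib[symmetric] sum.distrib sum_subtractf
          sum_distrib_left S_def card algebra_simps)
    finally have Q: "(\<Sum>j\<in>N. q j) = (real n * (\<alpha> - \<gamma>0) - S) / (real n + 1)"
      by (simp add: algebra_simps)
    show ?L
    proof
      fix i assume i: "i \<in> N"
      show "q i = \<alpha> - \<gamma>0 - F i - (\<Sum>j\<in>N. q j)"
        unfolding Q using R i CQ[OF i] n1 by (simp add: field_simps)
    qed
  qed
  finally show ?thesis by (simp add: N_def)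
qed

end

theory Submission imports Defs begin

text \<open>
  In the complete graph no link can be added, so stability says only that no firm gains by
  cutting a link. In fact no firm gains by cutting a link in any graph. By the first-order
  condition the equilibrium profit of a firm is the square of its equilibrium quantity
  (\<open>cournot_profit_eq_square\<close>), and these quantities are positive, because even in
  the worst case, a firm without any link whose rivals all have marginal cost \<open>\<gamma>0\<close>, the
  demand bound leaves a positive amount
  (\<open>cournot_quantity_pos\<close>). So it suffices to compare quantities. Cutting the link \<open>ij\<close> raises
  the costs of \<open>i\<close> and \<open>j\<close> and of nobody else; the quantity of \<open>i\<close> reacts to its own cost with
  weight \<open>n\<close> and to the cost of its rival \<open>j\<close> with weight \<open>1\<close> in the opposite direction. The
  hypothesis on forward differences says exactly that the first effect dominates, whatever the
  degrees of the two firms (\<open>cournot_quantity_remove_link_less\<close>).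
\<close>

lemma degree_less:
  assumes "g \<subseteq> complete_graph n" "i \<in> firms n"
  shows "degree g i < n"
proof -
  have "{e \<in> g. i \<in> e} \<subseteq> (\<lambda>j. {i, j}) ` (firms n - {i})"
  proof
    fix e assume "e \<in> {e \<in> g. i \<in> e}"
    then have e: "e \<subseteq> firms n" "card e = 2" "i \<in> e"
      using assms(1) by (auto simp: complete_graph_def)
    then obtain j where "e = {i, j}" "j \<noteq> i"
      by (auto simp: card_2_iff)
    with e show "e \<in> (\<lambda>j. {i, j}) ` (firms n - {i})" by auto
  qed
  then have "degree g i \<le> card (firms n - {i})"
    unfolding degree_def by (rule surj_card_le[rotated]) (simp add: firms_def)
  also have "\<dots> < card (firms n)"
    by (rule card_Diff1_less[OF _ assms(2)]) (simp add: firms_def)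
  finally show ?thesis by (simp add: firms_def)
qed

lemma degree_remove_link_endpoint:
  assumes "finite g" "{i, j} \<in> g"
  shows "degree g i = Suc (degree (remove_link g i j) i)"
proof -
  have "{e \<in> g. i \<in> e} = insert {i, j} {e \<in> remove_link g i j. i \<in> e}"
    using assms(2) by (auto simp: remove_link_def)
  moreover have "finite {e \<in> remove_link g i j. i \<in> e}" "{i, j} \<notin> remove_link g i j"
    using assms(1) by (auto simp: remove_link_def)
  ultimately show ?thesis by (simp add: degree_def)
qed

lemma degree_remove_link_other:
  "k \<noteq> i \<Longrightarrow> k \<noteq> j \<Longrightarrow> degree (remove_link g i j) k = degree g k"
  unfolding degree_def remove_link_def by (rule arg_cong[of _ _ card]) auto

lemma remove_link_commute: "remove_link g i j = remove_link g j i"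
  by (simp add: remove_link_def insert_commute)

text \<open>In equilibrium the quantity \<open>q\<close> of firm \<open>i\<close> maximises \<open>x * (a - x)\<close> over \<open>x\<close>, where \<open>a\<close>
  is the margin of \<open>i\<close> over its cost when it produces nothing. The maximiser satisfies
  \<open>a - q = q\<close>, so the margin left at the optimum is the quantity itself.\<close>

lemma cournot_profit_eq_square:
  assumes i: "i \<in> firms n"
  shows "cournot_profit n \<alpha> \<gamma>0 f i g = (cournot_quantity n \<alpha> \<gamma>0 f g i)\<^sup>2"
proof -
  define q where "q = cournot_quantity n \<alpha> \<gamma>0 f g"
  define a where "a = price n \<alpha> (q(i := 0)) - marginal_cost \<gamma>0 f g i"
  have fin: "finite (firms n)" by (simp add: firms_def)
  have deviation: "profit n \<alpha> \<gamma>0 f g (q(i := x)) i = x * (a - x)" for x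
  proof -
    have "(\<Sum>j\<in>firms n. (q(i := y)) j) = y + (\<Sum>j\<in>firms n - {i}. q j)" for y
      by (subst sum.remove[OF fin i]) (auto intro: sum.cong)
    then show ?thesis
      by (simp add: profit_def price_def a_def algebra_simps)
  qed
  have own: "profit n \<alpha> \<gamma>0 f g q i = q i * (a - q i)"
    using deviation[of "q i"] by simp
  have "cournot_equilibrium n \<alpha> \<gamma>0 f g q"
    by (simp add: cournot_equilibrium_iff q_def)
  then have "\<forall>x. x * (a - x) \<le> q i * (a - q i)"
    using i deviation own unfolding cournot_equilibrium_def by metis
  then have "2 * q i = a"
    by (simp add: quadratic_max_iff)
  then have "a - q i = q i" by simp
  then show ?thesis
    using own by (simp add: cournot_profit_def q_def power2_eq_square)
qed

lemma cournot_quantity_pos: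
  assumes antimono: "\<And>x. x \<ge> 0 \<Longrightarrow> f x \<le> f 0"
    and nonneg: "\<And>x. f x \<ge> 0"
    and demand: "\<alpha> - \<gamma>0 > real n * f 0"
  shows "cournot_quantity n \<alpha> \<gamma>0 f g i > 0"
proof -
  have "real n * f (real (degree g i)) \<le> real n * f 0"
    by (intro mult_left_mono antimono) auto
  moreover have "(\<Sum>j\<in>firms n - {i}. f (real (degree g j))) \<ge> 0"
    by (intro sum_nonneg nonneg)
  ultimately show ?thesis
    using demand by (simp add: cournot_quantity_def)
qed

lemma cournot_quantity_remove_link_less:
  assumes g: "g \<subseteq> complete_graph n" and ij: "{i, j} \<in> g"
    and diff: "\<And>k1 k2 :: nat. k1 < n \<Longrightarrow> k2 < n \<Longrightarrow>
           forward_diff f (real k1) - real n * forward_diff f (real k2) > 0"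
  shows "cournot_quantity n \<alpha> \<gamma>0 f (remove_link g i j) i < cournot_quantity n \<alpha> \<gamma>0 f g i"
proof -
  define h where "h = remove_link g i j"
  have "finite (complete_graph n)"
    by (rule finite_subset[of _ "Pow (firms n)"]) (auto simp: complete_graph_def firms_def)
  with g have fin: "finite g" by (rule finite_subset)
  have mem: "i \<in> firms n" "j \<in> firms n" and ne: "i \<noteq> j"
    using g ij by (auto simp: complete_graph_def)
  have h: "h \<subseteq> complete_graph n"
    using g by (auto simp: h_def remove_link_def)
  have di: "degree g i = Suc (degree h i)"
    unfolding h_def by (rule degree_remove_link_endpoint[OF fin ij])
  have dj: "degree g j = Suc (degree h j)"
    unfolding h_def using degree_remove_link_endpoint[of g j i] fin ij
    by (simp add: remove_link_commute insert_commute)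
  have split: "(\<Sum>k\<in>firms n - {i}. F k) = F j + (\<Sum>k\<in>firms n - {i} - {j}. F k)" for F :: "nat \<Rightarrow> real"
    using mem ne by (intro sum.remove) (auto simp: firms_def)
  have others: "(\<Sum>k\<in>firms n - {i} - {j}. f (real (degree h k)))
      = (\<Sum>k\<in>firms n - {i} - {j}. f (real (degree g k)))"
    by (intro sum.cong) (auto simp: h_def degree_remove_link_other)
  have "forward_diff f (real (degree h j)) - real n * forward_diff f (real (degree h i)) > 0"
    using degree_less[OF h] mem by (intro diff)
  then have "- real n * f (real (degree h i)) + f (real (degree h j))
      < - real n * f (real (degree g i)) + f (real (degree g j))"
    by (simp add: forward_diff_def di dj algebra_simps)
  then show ?thesis
    unfolding cournot_quantity_def h_def[symmetric] split others
    by (intro divide_strict_right_mono) auto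
qed

theorem theorem4p11:
  fixes n :: nat and \<alpha> \<gamma>0 :: real and f :: "real \<Rightarrow> real"
  assumes "\<And>x1 x2. x1 > x2 \<Longrightarrow> f x1 < f x2"
    and "convex_on UNIV f"
    and "\<And>x. f x > 0"
    and "\<alpha> - \<gamma>0 > real n * f 0"
    and "\<And>k1 k2 :: nat. k1 < n \<Longrightarrow> k2 < n \<Longrightarrow>
           forward_diff f (real k1) - real n * forward_diff f (real k2) > 0"
  shows "pairwise_stable n (cournot_profit n \<alpha> \<gamma>0 f) (complete_graph n)"
proof -
  have pos: "cournot_quantity n \<alpha> \<gamma>0 f g i > 0" for g i
  proof (rule cournot_quantity_pos)
    show "f x \<le> f 0" if "x \<ge> 0" for x
      using that assms(1)[of 0 x] by (cases "x = 0") auto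
    show "f x \<ge> 0" for x
      using assms(3)[of x] by simp
  qed (fact assms(4))
  have cut: "cournot_profit n \<alpha> \<gamma>0 f i (remove_link (complete_graph n) i j)
      \<le> cournot_profit n \<alpha> \<gamma>0 f i (complete_graph n)"
    if "i \<in> firms n" "{i, j} \<in> complete_graph n" for i j
    unfolding cournot_profit_eq_square[OF that(1)]
    using cournot_quantity_remove_link_less[OF subset_refl that(2) assms(5)] pos
    by (intro power_mono) (auto intro: less_imp_le)
  have complete: "{i, j} \<in> complete_graph n" if "i \<in> firms n" "j \<in> firms n" "i \<noteq> j" for i j
    using that by (simp add: complete_graph_def)
  show ?thesis
    unfolding pairwise_stable_def using cut complete by blast
qed

end
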